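(* Let $n$ be a positive integer and let $f(x_1,\ldots,x_n)\in\mathbb{Q}[x_1,\ldots,x_n]$ be a polynomial (not necessarily symmetric) of degree $r$. Put $T=\max\{[(r+n-2)/2],[(n-1)/2]\}$. Then there exist polynomials $e_{f,l}(x)\in\mathbb{Q}[x]$ ($0\leq l\leq T$), depending only on $l$ and $f$ (in particular not on $k$), with $\deg e_{f,l}(x)\leq r+n-2l-1$, such that for every integer $k\geq n$, $$\sum_{\substack{k_1+\cdots+k_n=k\\ k_j\geq 1}}f(k_1,\ldots,k_n)\,t(2k_1)\cdots t(2k_n)=\sum_{l=0}^{\min\{T,k\}}e_{f,l}(k)\,\zeta(2l)\,t(2k-2l),$$ where the sum on the left runs over all $n$-tuples $(k_1,\ldots,k_n)$ of positive integers with sum $k$.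
   Context: For an integer $s\geq 2$, $t(s)=\sum_{m\geq 1,\ m\text{ odd}}m^{-s}$. $\zeta$ is the Riemann zeta function. Conventions: $\zeta(0)=-1/2$ and $t(0)=0$. For a real number $\alpha$, $[\alpha]$ denotes the greatest integer not exceeding $\alpha$. The zero polynomial is regarded as having degree $-\infty$ in degree bounds for the coefficient polynomials. *)

theory Defs
  imports "HOL-Analysis.Analysis" "HOL-Library.Poly_Mapping"
    "HOL-Computational_Algebra.Polynomial"
begin

text \<open>
  A multivariate polynomial is a finitely supported map from monomials to coefficients, and a
  monomial is a finitely supported map from variable indices to exponents. The multiplication of
  \<^type>\<open>poly_mapping\<close> (convolution) makes this the polynomial ring in countably many variables.
\<close>

type_synonym 'a mvpoly = "(nat \<Rightarrow>\<^sub>0 nat) \<Rightarrow>\<^sub>0 'a"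

definition mvpoly_vars :: "'a::zero mvpoly \<Rightarrow> nat set" where
  "mvpoly_vars f = (\<Union>m\<in>Poly_Mapping.keys f. Poly_Mapping.keys m)"

text \<open>As for univariate \<^const>\<open>degree\<close>, the zero polynomial gets total degree \<open>0\<close>.\<close>

definition mvpoly_degree :: "'a::zero mvpoly \<Rightarrow> nat" where
  "mvpoly_degree f =
    Max (insert 0 ((\<lambda>m. \<Sum>i\<in>Poly_Mapping.keys m. Poly_Mapping.lookup m i) `
      Poly_Mapping.keys f))"

definition mvpoly_eval :: "'a::comm_semiring_1 mvpoly \<Rightarrow> (nat \<Rightarrow> 'a) \<Rightarrow> 'a" where
  "mvpoly_eval f x =
    (\<Sum>m\<in>Poly_Mapping.keys f. Poly_Mapping.lookup f m *
      (\<Prod>i\<in>Poly_Mapping.keys m. x i ^ Poly_Mapping.lookup m i))"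

text \<open>
  Riemann's zeta function at the natural numbers other than \<open>1\<close> (the series at \<open>1\<close> diverges, and
  the value there is meaningless). At \<open>0\<close>, where the series diverges too, the value is the one
  given by analytic continuation.
\<close>

definition zeta :: "nat \<Rightarrow> real" where
  "zeta s = (if s = 0 then - 1 / 2 else suminf (\<lambda>m. 1 / real (m + 1) ^ s))"

text \<open>
  The sum of \<open>m\<^sup>-\<^sup>s\<close> over the odd \<open>m \<ge> 1\<close>, for \<open>s \<ge> 2\<close>; the value \<open>0\<close> at \<open>s = 0\<close> is a convention.
\<close>

definition odd_zeta :: "nat \<Rightarrow> real" where
  "odd_zeta s = (if s = 0 then 0 else suminf (\<lambda>m. 1 / real (2 * m + 1) ^ s))"

definition compositions :: "nat \<Rightarrow> nat \<Rightarrow> (nat \<Rightarrow> nat) set" where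
  "compositions n k = {\<kappa> \<in> {1..n} \<rightarrow>\<^sub>E {1..}. (\<Sum>j=1..n. \<kappa> j) = k}"

lemma finite_compositions: "finite (compositions n k)"
proof (rule finite_subset)
  show "compositions n k \<subseteq> {1..n} \<rightarrow>\<^sub>E {1..k}"
  proof
    fix \<kappa> assume k: "\<kappa> \<in> compositions n k"
    have "\<kappa> j \<le> k" if "j \<in> {1..n}" for j
      using member_le_sum[of j "{1..n}" \<kappa>] k that by (auto simp: compositions_def)
    with k show "\<kappa> \<in> {1..n} \<rightarrow>\<^sub>E {1..k}"
      by (auto simp: compositions_def PiE_iff)
  qed
qed (auto intro: finite_PiE)

end

theory Submission
  imports Defs
begin

text \<open>
  Put \<open>u = \<pi>x/2\<close>, \<open>X = u\<^sup>2\<close> and \<open>h = u tan u\<close>. The partial fractions of the tangent give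
  \<open>\<Sum>\<^sub>k t(2k) x\<^bsup>2k\<^esup> = h/2\<close>, so that \<open>t(2k) = (\<pi>\<^sup>2/4)\<^sup>k h\<^sub>k / 2\<close>, where \<open>h\<^sub>k\<close> is the rational coefficient of \<open>X\<^sup>k\<close>
  in \<open>h\<close>. Also \<open>\<zeta>(2l) = (\<pi>\<^sup>2/4)\<^sup>l z\<^sub>l\<close> with \<open>z\<^sub>l\<close> rational and nonzero. On both sides of the claim the powers of
  \<open>\<pi>\<close> combine to \<open>(\<pi>\<^sup>2/4)\<^sup>k\<close>, and the claim becomes one about rational power series: with \<open>D = X d/dX\<close>, the
  product \<open>\<Prod>\<^sub>j D\<^bsup>\<rho> j\<^esup> h\<close> that belongs to a monomial of \<open>f\<close> agrees, from the coefficient of \<open>X\<^sup>n\<close> on, with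
  \<open>\<Sum>\<^sub>l e\<^sub>l(D) (X\<^sup>l h)\<close>.
  
  The tool is the Riccati equation \<open>2 D h = h + X + h\<^sup>2\<close>. Give \<open>h\<close> the weight \<open>1\<close> and \<open>X\<close> the weight \<open>2\<close>. Then \<open>D\<close>
  raises the weight of a polynomial in \<open>h\<close> and \<open>X\<close> by at most \<open>1\<close>, so the product has weight at most
  \<open>R + n\<close>, where \<open>R = \<Sum>\<^sub>j \<rho> j\<close> (\<open>weighted_euler_op\<close>, \<open>weighted_prod\<close>). Conversely the equation expresses the powers of \<open>h\<close> by
  the \<open>X\<^sup>l D\<^sup>i h\<close> and the \<open>X\<^sup>l\<close> of no larger weight (\<open>reduced_tan_series_power\<close>, \<open>weighted_imp_reduced\<close>). This
  gives \<open>e\<^sub>l\<close> of degree at most \<open>R + n - 2l - 1\<close>, up to an error \<open>Q(X)\<close> and up to a possible extra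
  term with \<open>2l + 1 = R + n\<close>.
  
  Both defects are removed by letting \<open>u\<close> tend to \<open>\<i>\<infinity>\<close>. There \<open>tan u\<close> tends to \<open>\<i>\<close>, so \<open>h\<close> behaves like \<open>s = \<i>u\<close> and
  each \<open>D\<^sup>i h\<close> like a multiple of \<open>s\<close>. The product behaves like a multiple of \<open>s\<^sup>n\<close>, the terms with
  \<open>h\<close> are odd in \<open>s\<close>, and \<open>Q(X) = Q(- s\<^sup>2)\<close> is even. Hence \<open>Q\<close> has at most the term \<open>X\<^bsup>n/2\<^esup>\<close>, of degree below \<open>n\<close>,
  and the extra term, whose \<open>e\<^sub>l\<close> is a constant, vanishes unless \<open>2l + 1 = n\<close>
  (\<open>euler_op_product_reduction\<close>). In algebraic terms this limit is the homomorphism with \<open>h \<mapsto> s\<close>, \<open>X \<mapsto> - s\<^sup>2\<close>, which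
  is compatible with \<open>D\<close> acting as \<open>(s/2) d/ds\<close>.
\<close>

unbundle no vec_syntax
unbundle fps_syntax

section \<open>Even values of the odd zeta sum\<close>

text \<open>
  The reflection formula makes \<open>\<Gamma>(1/2 + y) \<Gamma>(1/2 - y) cos (\<pi> y)\<close> constant; its logarithmic
  derivative therefore vanishes.
\<close>

lemma Digamma_half_reflection:
  fixes y :: real
  assumes "\<bar>y\<bar> < 1 / 2"
  shows "Digamma (1/2 + y) - Digamma (1/2 - y) = pi * tan (pi * y)"
proof -
  define f where "f = (\<lambda>y::real. Gamma (1/2 + y) * Gamma (1/2 - y) * cos (pi * y))"
  have cos_pos: "cos (pi * x) > 0" if "\<bar>x\<bar> < 1/2" for x :: real
  proof (rule cos_gt_zero_pi)
    show "- (pi / 2) < pi * x" "pi * x < pi / 2"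
      using that mult_strict_left_mono[of "- (1/2)" x pi] mult_strict_left_mono[of x "1/2" pi]
      by (auto simp: abs_less_iff)
  qed
  have f_eq: "f x = pi" if x: "\<bar>x\<bar> < 1/2" for x
  proof -
    have "complex_of_real (Gamma (1/2 + x) * Gamma (1/2 - x)) =
        Gamma (complex_of_real (1/2 + x)) * Gamma (1 - complex_of_real (1/2 + x))"
    proof -
      have "1 - complex_of_real (1/2 + x) = complex_of_real (1/2 - x)"
        by simp
      then show ?thesis by (simp only: Gamma_complex_of_real of_real_mult)
    qed
    also have "\<dots> = of_real pi / sin (of_real pi * complex_of_real (1/2 + x))"
      by (rule Gamma_reflection_complex)
    also have "\<dots> = complex_of_real (pi / sin (pi * (1/2 + x)))"
      by (simp only: of_real_divide of_real_mult[symmetric] sin_of_real)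
    finally have "Gamma (1/2 + x) * Gamma (1/2 - x) = pi / sin (pi * (1/2 + x))"
      by (simp only: of_real_eq_iff)
    also have "sin (pi * (1/2 + x)) = cos (pi * x)"
      by (simp add: distrib_left sin_add)
    finally show ?thesis
      using cos_pos[OF x] by (simp add: f_def field_simps)
  qed
  have pos: "Gamma (1/2 + y) > 0" "Gamma (1/2 - y) > 0"
    using assms by auto
  have nonpole: "1/2 + y \<notin> \<int>\<^sub>\<le>\<^sub>0" "1/2 - y \<notin> \<int>\<^sub>\<le>\<^sub>0"
    using assms by (auto elim!: nonpos_Ints_cases)
  have "(f has_field_derivative
      (Gamma (1/2 + y) * Digamma (1/2 + y) * Gamma (1/2 - y) -
       Gamma (1/2 + y) * (Gamma (1/2 - y) * Digamma (1/2 - y))) * cos (pi * y) -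
      Gamma (1/2 + y) * Gamma (1/2 - y) * (sin (pi * y) * pi)) (at y)"
    unfolding f_def using nonpole
    by (auto intro!: derivative_eq_intros simp: algebra_simps)
  moreover have "(f has_field_derivative 0) (at y)"
  proof (rule has_field_derivative_transform_within_open[where f = "\<lambda>_. pi" and S = "{-1/2<..<1/2}"])
    show "y \<in> {-1/2<..<1/2}" using assms by auto
    show "pi = f x" if "x \<in> {-1/2<..<1/2}" for x
      using that f_eq[of x] by (auto simp: abs_less_iff)
  qed auto
  ultimately have "(Gamma (1/2 + y) * Digamma (1/2 + y) * Gamma (1/2 - y) -
       Gamma (1/2 + y) * (Gamma (1/2 - y) * Digamma (1/2 - y))) * cos (pi * y) -
      Gamma (1/2 + y) * Gamma (1/2 - y) * (sin (pi * y) * pi) = 0"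
    by (rule DERIV_unique)
  then have "Gamma (1/2 + y) * Gamma (1/2 - y) *
      ((Digamma (1/2 + y) - Digamma (1/2 - y)) * cos (pi * y) - pi * sin (pi * y)) = 0"
    by (simp add: algebra_simps)
  then have "(Digamma (1/2 + y) - Digamma (1/2 - y)) * cos (pi * y) = pi * sin (pi * y)"
    using pos by simp
  then show ?thesis
    using cos_pos[OF assms] by (simp add: tan_def field_simps)
qed

text \<open>
  The reflection formula above at \<open>y = x/2\<close>, with the series of the two Digamma values subtracted
  term by term.
\<close>

lemma tan_partial_fractions:
  fixes x :: real
  assumes "\<bar>x\<bar> < 1"
  shows "(\<lambda>m. x\<^sup>2 / (real (2 * m + 1) ^ 2 - x\<^sup>2)) sums (pi * x / 4 * tan (pi * x / 2))"
proof -
  define y where "y = x / 2"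
  have y: "\<bar>y\<bar> < 1/2" using assms by (simp add: y_def)
  have dig: "(\<lambda>m. inverse (of_nat (Suc m)) - inverse (z + of_nat m)) sums
      (Digamma z + euler_mascheroni)" if "z \<noteq> 0" for z :: real
    using summable_sums[OF summable_Digamma[OF that]] by (simp add: Digamma_def)
  have "(\<lambda>m. (inverse (of_nat (Suc m)) - inverse (1/2 + y + of_nat m)) -
      (inverse (of_nat (Suc m)) - inverse (1/2 - y + of_nat m))) sums
      ((Digamma (1/2 + y) + euler_mascheroni) - (Digamma (1/2 - y) + euler_mascheroni))"
    using y by (intro sums_diff dig) auto
  then have "(\<lambda>m. inverse (1/2 - y + of_nat m) - inverse (1/2 + y + of_nat m)) sums
      (pi * tan (pi * y))"
    using Digamma_half_reflection[OF y] by simp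
  from sums_mult[OF this, of "x / 4"]
  have "(\<lambda>m. x / 4 * (inverse (1/2 - y + of_nat m) - inverse (1/2 + y + of_nat m))) sums
      (pi * x / 4 * tan (pi * x / 2))"
    by (simp add: y_def mult_ac)
  moreover have "x / 4 * (inverse (1/2 - y + of_nat m) - inverse (1/2 + y + of_nat m)) =
      x\<^sup>2 / (real (2 * m + 1) ^ 2 - x\<^sup>2)" for m
  proof -
    have nz: "2 * real m + 1 - x > 0" "2 * real m + 1 + x > 0"
      using assms by (auto simp: abs_less_iff)
    have "inverse (1/2 - y + of_nat m) = 2 / (2 * real m + 1 - x)"
      "inverse (1/2 + y + of_nat m) = 2 / (2 * real m + 1 + x)"
      using nz by (auto simp: y_def field_simps)
    moreover have "real (2 * m + 1) ^ 2 - x\<^sup>2 = (2 * real m + 1 - x) * (2 * real m + 1 + x)"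
      by (simp add: power2_eq_square algebra_simps)
    moreover have "x / 4 * (2 / a - 2 / b) = x\<^sup>2 / (a * b)"
      if "a > 0" "b > 0" "b - a = 2 * x" for a b :: real
    proof -
      have "x / 4 * (2 / a - 2 / b) = x / 2 * (b - a) / (a * b)"
        using that(1,2) by (simp add: field_simps)
      then show ?thesis by (simp add: that(3) power2_eq_square)
    qed
    ultimately show ?thesis using nz by simp
  qed
  ultimately show ?thesis by (simp only:)
qed

lemma summable_inverse_odd_power:
  assumes "s \<ge> 2"
  shows "summable (\<lambda>m. 1 / real (2 * m + 1) ^ s)"
proof (rule summable_comparison_test')
  show "summable (\<lambda>m. inverse (real (m + 1) ^ s))"
    using inverse_power_summable[OF assms, where 'a = real] by (rule summable_ignore_initial_segment[where k = 1])
  show "norm (1 / real (2 * m + 1) ^ s) \<le> inverse (real (m + 1) ^ s)" for m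
  proof -
    have "real (m + 1) ^ s \<le> real (2 * m + 1) ^ s" by (intro power_mono) auto
    then show ?thesis by (simp add: inverse_eq_divide frac_le)
  qed
qed

lemma odd_zeta_sums:
  assumes "s \<ge> 2"
  shows "(\<lambda>m. 1 / real (2 * m + 1) ^ s) sums odd_zeta s"
  using summable_sums[OF summable_inverse_odd_power[OF assms]] assms by (simp add: odd_zeta_def)

text \<open>
  Each partial fraction is a geometric series in \<open>x\<^sup>2\<close>. All terms of the resulting double series are
  nonnegative, so that the order of summation may be exchanged.
\<close>

lemma odd_zeta_generating_function:
  fixes x :: real
  assumes "\<bar>x\<bar> < 1"
  shows "(\<lambda>k. odd_zeta (2 * k) * x ^ (2 * k)) sums (pi * x / 4 * tan (pi * x / 2))"
proof -
  define F where "F = (\<lambda>(m, k). (x\<^sup>2 / real (2 * m + 1) ^ 2) ^ Suc k)"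
  let ?S = "pi * x / 4 * tan (pi * x / 2)"
  have x2: "x\<^sup>2 < 1" using assms by (simp add: abs_square_less_1)
  have rows: "((\<lambda>k. F (m, k)) has_sum (x\<^sup>2 / (real (2 * m + 1) ^ 2 - x\<^sup>2))) UNIV" for m
  proof -
    have le: "1 \<le> real (2 * m + 1) ^ 2" by (rule one_le_power) simp
    define q where "q = x\<^sup>2 / real (2 * m + 1) ^ 2"
    have "q \<le> x\<^sup>2" "q \<ge> 0" using le by (auto simp: q_def divide_le_eq mult_le_cancel_left1)
    with x2 have "(\<lambda>k. q * q ^ k) sums (q * (1 / (1 - q)))"
      by (intro sums_mult geometric_sums) auto
    moreover have "q * (1 / (1 - q)) = x\<^sup>2 / (real (2 * m + 1) ^ 2 - x\<^sup>2)"
      using le x2 by (simp add: q_def field_simps)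
    ultimately show ?thesis
      using \<open>q \<ge> 0\<close> by (intro sums_nonneg_imp_has_sum) (auto simp: F_def q_def)
  qed
  have outer: "((\<lambda>m. x\<^sup>2 / (real (2 * m + 1) ^ 2 - x\<^sup>2)) has_sum ?S) UNIV"
  proof (rule sums_nonneg_imp_has_sum[OF tan_partial_fractions[OF assms]])
    fix m
    have "1 \<le> real (2 * m + 1) ^ 2" by (rule one_le_power) simp
    with x2 have "0 \<le> real (2 * m + 1) ^ 2 - x\<^sup>2" by linarith
    then show "0 \<le> x\<^sup>2 / (real (2 * m + 1) ^ 2 - x\<^sup>2)" by (intro divide_nonneg_nonneg) auto
  qed
  have "F summable_on (UNIV \<times> UNIV)"
    using has_sum_imp_summable[OF outer]
    by (rule summable_on_SigmaI[OF rows]) (simp add: F_def)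
  with rows outer have "(F has_sum ?S) (UNIV \<times> UNIV)"
    by (rule has_sum_SigmaI)
  then have sw: "((\<lambda>(k, m). F (m, k)) has_sum ?S) (UNIV \<times> UNIV)"
    by (subst (asm) has_sum_swap)
  have cols: "((\<lambda>m. case (k, m) of (k, m) \<Rightarrow> F (m, k)) has_sum
      (odd_zeta (2 * Suc k) * x ^ (2 * Suc k))) UNIV" for k
  proof (rule sums_nonneg_imp_has_sum)
    have "(\<lambda>m. 1 / real (2 * m + 1) ^ (2 * Suc k) * x ^ (2 * Suc k)) sums
        (odd_zeta (2 * Suc k) * x ^ (2 * Suc k))"
      by (intro sums_mult2 odd_zeta_sums) simp
    moreover have "F (m, k) = 1 / real (2 * m + 1) ^ (2 * Suc k) * x ^ (2 * Suc k)" for m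
      unfolding F_def prod.case power_divide power_mult[symmetric] by simp
    ultimately show "(\<lambda>m. case (k, m) of (k, m) \<Rightarrow> F (m, k)) sums
        (odd_zeta (2 * Suc k) * x ^ (2 * Suc k))"
      by simp
  qed (simp add: F_def)
  have "((\<lambda>k. odd_zeta (2 * Suc k) * x ^ (2 * Suc k)) has_sum ?S) UNIV"
    using sw cols by (rule has_sum_SigmaD)
  from has_sum_imp_sums[OF this] show ?thesis
    by (subst (asm) sums_Suc_iff) (simp add: odd_zeta_def)
qed

text \<open>
  If \<open>F - G\<close> had lowest term \<open>c x\<^sup>n\<close>, then dividing the expansion of \<open>f - f = 0\<close> by \<open>x\<^sup>n\<close> would give a
  function that is continuous at \<open>0\<close>, has the value \<open>c\<close> there and is \<open>0\<close> elsewhere. Unlike the identity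
  theorem for holomorphic functions, this works over the reals.
\<close>

lemma has_fps_expansion_unique:
  fixes F G :: "'a :: {banach, real_normed_field} fps"
  assumes "f has_fps_expansion F" "f has_fps_expansion G"
  shows "F = G"
proof (rule ccontr)
  assume "F \<noteq> G"
  define n where "n = subdegree (F - G)"
  have "(\<lambda>x. f x - f x) has_fps_expansion (F - G)"
    by (intro has_fps_expansion_diff assms)
  then have "(\<lambda>x. if x = 0 then (F - G) $ n else 0 / x ^ n) has_fps_expansion fps_shift n (F - G)"
    unfolding diff_self
    by (rule has_fps_expansion_shift[where n = n and c = "(F - G) $ n"]) (auto simp: n_def)
  then have "continuous (at 0) (\<lambda>x. if x = 0 then (F - G) $ n else 0 / x ^ n)"
    by (rule has_fps_expansion_imp_continuous)
  then have "(\<lambda>x. if x = 0 then (F - G) $ n else 0 / x ^ n) \<midarrow>0\<rightarrow> (F - G) $ n"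
    by (simp add: continuous_within)
  moreover have "(\<lambda>x::'a. if x = 0 then (F - G) $ n else 0 / x ^ n) \<midarrow>0\<rightarrow> 0"
    by (rule Lim_transform_eventually[OF tendsto_const])
       (auto simp: eventually_at_filter)
  ultimately have "(F - G) $ n = 0"
    by (rule tendsto_unique[rotated]) simp
  with \<open>F \<noteq> G\<close> show False
    unfolding n_def using nth_subdegree_nonzero[of "F - G"] by simp
qed

lemma fps_tan_deriv_eq: "fps_deriv (fps_tan c) = fps_const c * (1 + fps_tan c ^ 2)"
  for c :: "'a::field_char_0"
proof -
  have nz: "fps_cos c $ 0 \<noteq> 0" by (simp add: fps_cos_def)
  have unit: "inverse (fps_cos c) * fps_cos c = 1"
    using nz by (rule inverse_mult_eq_1)
  have "fps_const c / (fps_cos c)\<^sup>2 = fps_const c * inverse (fps_cos c) ^ 2"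
    using nz by (simp add: fps_divide_unit fps_inverse_power)
  also have "inverse (fps_cos c) ^ 2 =
      (fps_cos c ^ 2 + fps_sin c ^ 2) * inverse (fps_cos c) ^ 2"
    by (simp add: fps_sin_cos_sum_of_squares)
  also have "\<dots> = (inverse (fps_cos c) * fps_cos c) ^ 2 + fps_tan c ^ 2"
    using nz by (simp add: fps_tan_def fps_divide_unit algebra_simps)
  finally show ?thesis by (simp add: unit fps_tan_deriv)
qed

lemma sum_even_indices:
  fixes f :: "nat \<Rightarrow> 'a::comm_monoid_add"
  assumes "\<And>i. odd i \<Longrightarrow> f i = 0"
  shows "(\<Sum>i\<le>2 * k. f i) = (\<Sum>i\<le>k. f (2 * i))"
  using assms by (induction k) auto

text \<open>
  The generating function \<open>G = \<pi>x/4 tan (\<pi>x/2)\<close> inherits the Riccati equation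
  \<open>2 x G' = 2 G + (\<pi>x/2)\<^sup>2 + 4 G\<^sup>2\<close> from \<open>tan' = 1 + tan\<^sup>2\<close>; the lemma compares coefficients of \<open>x\<^bsup>2k\<^esup>\<close>.
\<close>

lemma odd_zeta_riccati:
  assumes "k \<ge> 1"
  shows "(4 * real k - 2) * odd_zeta (2 * k) =
    4 * (\<Sum>i\<le>k. odd_zeta (2 * i) * odd_zeta (2 * (k - i))) + (if k = 1 then pi\<^sup>2 / 4 else 0)"
proof -
  define A where "A = Abs_fps (\<lambda>j. if even j then odd_zeta j else 0)"
  define P where "P = fps_tan (pi / 2)"
  have "(\<lambda>x. pi * x / 4 * tan (pi * x / 2)) has_fps_expansion A"
  proof (rule has_fps_expansionI)
    have "\<forall>\<^sub>F x in nhds (0::real). x \<in> {-1<..<1}"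
      by (intro eventually_nhds_in_open) auto
    then show "\<forall>\<^sub>F x in nhds 0. (\<lambda>n. A $ n * x ^ n) sums (pi * x / 4 * tan (pi * x / 2))"
    proof eventually_elim
      case (elim x)
      then have "(\<lambda>k. odd_zeta (2 * k) * x ^ (2 * k)) sums (pi * x / 4 * tan (pi * x / 2))"
        by (intro odd_zeta_generating_function) (auto simp: abs_less_iff)
      then have "(\<lambda>k. A $ (2 * k) * x ^ (2 * k)) sums (pi * x / 4 * tan (pi * x / 2))"
        by (simp add: A_def)
      moreover have "strict_mono (\<lambda>k::nat. 2 * k)" by (simp add: strict_mono_def)
      moreover have "A $ n * x ^ n = 0" if "n \<notin> range (\<lambda>k::nat. 2 * k)" for n
        using that by (auto simp: A_def elim!: evenE)
      ultimately show ?case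
        using sums_mono_reindex[of "\<lambda>k::nat. 2 * k" "\<lambda>n. A $ n * x ^ n"] by blast
    qed
  qed
  moreover have "(\<lambda>x. pi / 4 * (x * tan (pi / 2 * x))) has_fps_expansion
      fps_const (pi / 4) * (fps_X * P)"
    unfolding P_def by (intro fps_expansion_intros)
  ultimately have A_eq: "A = fps_const (pi / 4) * (fps_X * P)"
    by (intro has_fps_expansion_unique[of "\<lambda>x. pi * x / 4 * tan (pi * x / 2)"]) (simp_all add: mult_ac)
  have four: "4 * A = fps_const pi * (fps_X * P)"
    unfolding A_eq mult.assoc[symmetric] numeral_fps_const fps_const_mult by simp
  \<comment> \<open>This is \<open>P' = \<pi>/2 (1 + P\<^sup>2)\<close>, multiplied by \<open>2 \<pi> x\<^sup>2\<close> so that \<open>P\<close> occurs only in \<open>4 A = \<pi> x P\<close>.\<close>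
  have "2 * (fps_X * fps_deriv (4 * A)) =
      2 * (4 * A) + (fps_const pi * fps_X) ^ 2 + (4 * A) ^ 2"
  proof -
    have two: "2 * fps_const (pi / 2) = fps_const pi"
      unfolding numeral_fps_const fps_const_mult by simp
    have "2 * (fps_X * fps_deriv (4 * A)) =
        2 * (fps_const pi * (fps_X * P)) +
        fps_const pi * (2 * fps_const (pi / 2)) * (fps_X ^ 2 * (1 + P ^ 2))"
      unfolding four by (simp add: P_def fps_tan_deriv_eq algebra_simps power2_eq_square)
    then show ?thesis
      unfolding two four by (simp add: algebra_simps power2_eq_square)
  qed
  then have eq: "8 * (fps_X * fps_deriv A) = 8 * A + fps_const (pi\<^sup>2) * fps_X ^ 2 + 16 * (A * A)"
    by (simp add: power2_eq_square fps_const_mult[symmetric] algebra_simps del: fps_const_mult)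
  have conv: "(A * A) $ (2 * k) = (\<Sum>i\<le>k. odd_zeta (2 * i) * odd_zeta (2 * (k - i)))"
    unfolding fps_mult_nth atLeast0AtMost
    by (subst sum_even_indices) (auto simp: A_def algebra_simps)
  have nth8: "(8 * B) $ j = 8 * B $ j" and nth16: "(16 * B) $ j = 16 * B $ j"
    for B :: "real fps" and j
    by (simp_all add: numeral_fps_const)
  have "8 * (fps_X * fps_deriv A) $ (2 * k) =
      8 * A $ (2 * k) + (fps_const (pi\<^sup>2) * fps_X ^ 2) $ (2 * k) + 16 * (A * A) $ (2 * k)"
    unfolding nth8[symmetric] nth16[symmetric] fps_add_nth[symmetric] eq ..
  moreover have "(fps_X * fps_deriv A) $ (2 * k) = 2 * real k * odd_zeta (2 * k)"
    using assms by (simp add: A_def)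
  moreover have "(fps_const (pi\<^sup>2) * fps_X ^ 2) $ (2 * k) = (if k = 1 then pi\<^sup>2 else 0)"
    by simp
  moreover have "A $ (2 * k) = odd_zeta (2 * k)"
    by (simp add: A_def)
  ultimately show ?thesis
    unfolding conv by (simp add: algebra_simps split del: if_split) (simp split: if_splits)
qed

text \<open>
  The coefficient of \<open>u\<^bsup>2k\<^esup>\<close> in \<open>u tan u\<close>. The recursion is the Riccati equation of \<open>u tan u\<close> in
  coefficients; it keeps the numbers rational by construction.
\<close>

fun tan_coeff :: "nat \<Rightarrow> rat" where
  "tan_coeff k =
    (if k = 0 then 0 else if k = 1 then 1
     else (\<Sum>i\<in>{1..<k}. tan_coeff i * tan_coeff (k - i)) / of_nat (2 * k - 1))"

declare tan_coeff.simps [simp del]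

lemma tan_coeff_0 [simp]: "tan_coeff 0 = 0"
  and tan_coeff_1 [simp]: "tan_coeff (Suc 0) = 1"
  by (simp_all add: tan_coeff.simps)

lemma tan_coeff_riccati:
  "2 * of_nat k * tan_coeff k =
    tan_coeff k + (if k = 1 then 1 else 0) + (\<Sum>i\<le>k. tan_coeff i * tan_coeff (k - i))"
proof (cases "k \<le> 1")
  case True
  then have "k = 0 \<or> k = 1" by auto
  then show ?thesis by auto
next
  case False
  have "(\<Sum>i\<le>k. tan_coeff i * tan_coeff (k - i)) = (\<Sum>i\<in>{1..<k}. tan_coeff i * tan_coeff (k - i))"
  proof (rule sum.mono_neutral_right)
    show "\<forall>i\<in>{..k} - {1..<k}. tan_coeff i * tan_coeff (k - i) = 0"
    proof
      fix i assume "i \<in> {..k} - {1..<k}"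
      then have "i = 0 \<or> i = k" by auto
      then show "tan_coeff i * tan_coeff (k - i) = 0" by auto
    qed
  qed auto
  also have "\<dots> = of_nat (2 * k - 1) * tan_coeff k"
    using False by (subst (3) tan_coeff.simps) simp
  also have "of_nat (2 * k - 1) = (2 * of_nat k - 1 :: rat)"
    using False by simp
  finally show ?thesis using False by (simp add: algebra_simps)
qed

text \<open>
  Both sides satisfy the same quadratic recurrence, with the same initial values. It determines the
  \<open>k\<close>-th term because the summands with index \<open>0\<close> or \<open>k\<close> vanish.
\<close>

lemma odd_zeta_eq_tan_coeff: "odd_zeta (2 * k) = (pi\<^sup>2 / 4) ^ k * of_rat (tan_coeff k) / 2"
proof (induction k rule: less_induct)
  case (less k)
  have o0: "odd_zeta 0 = 0" by (simp add: odd_zeta_def)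
  show ?case
  proof (cases "k \<le> 1")
    case True
    then have "k = 0 \<or> k = 1" by auto
    then show ?thesis using odd_zeta_riccati[of 1] by (auto simp: o0)
  next
    case False
    let ?p = "pi\<^sup>2 / 4" and ?c = "\<lambda>i. real_of_rat (tan_coeff i)"
    have ends: "i = 0 \<or> i = k" if "\<not> (i < k \<and> k - i < k)" "i \<le> k" for i
      using that by auto
    have "(4 * real k - 2) * odd_zeta (2 * k) =
        4 * (\<Sum>i\<le>k. odd_zeta (2 * i) * odd_zeta (2 * (k - i)))"
      using odd_zeta_riccati[of k] False by simp
    also have "(\<Sum>i\<le>k. odd_zeta (2 * i) * odd_zeta (2 * (k - i))) =
        (\<Sum>i\<le>k. ?p ^ k / 4 * (?c i * ?c (k - i)))"
    proof (rule sum.cong)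
      fix i assume i: "i \<in> {..k}"
      show "odd_zeta (2 * i) * odd_zeta (2 * (k - i)) = ?p ^ k / 4 * (?c i * ?c (k - i))"
      proof (cases "i < k \<and> k - i < k")
        case True
        then have "?p ^ k = ?p ^ i * ?p ^ (k - i)"
          by (simp add: power_add[symmetric])
        with True show ?thesis by (simp only: less) simp
      next
        case False
        with ends[of i] i show ?thesis by (auto simp: o0)
      qed
    qed simp
    also have "\<dots> = ?p ^ k / 4 * of_rat (\<Sum>i\<le>k. tan_coeff i * tan_coeff (k - i))"
      by (simp add: sum_distrib_left of_rat_sum of_rat_mult)
    also have "(\<Sum>i\<le>k. tan_coeff i * tan_coeff (k - i)) = (2 * of_nat k - 1) * tan_coeff k"
      using tan_coeff_riccati[of k] False by (simp add: algebra_simps)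
    also have "real_of_rat ((2 * of_nat k - 1) * tan_coeff k) = (2 * real k - 1) * ?c k"
      by (simp add: of_rat_mult of_rat_diff)
    also have "4 * (?p ^ k / 4 * ((2 * real k - 1) * ?c k)) = (4 * real k - 2) * (?p ^ k * ?c k / 2)"
      by (simp add: field_simps)
    finally show ?thesis using False by (subst (asm) mult_left_cancel) auto
  qed
qed

lemma zeta_sums:
  assumes "s \<ge> 2"
  shows "(\<lambda>m. 1 / real (m + 1) ^ s) sums zeta s"
proof -
  have "summable (\<lambda>m. inverse (real (m + 1) ^ s))"
    using inverse_power_summable[OF assms, where 'a = real]
    by (rule summable_ignore_initial_segment[where k = 1])
  then show ?thesis using assms
    by (simp add: zeta_def inverse_eq_divide summable_sums)
qed

text \<open>
  The even terms of the zeta series add up to \<open>\<zeta>(s) / 2\<^sup>s\<close>.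
\<close>

lemma odd_zeta_eq_zeta:
  assumes "s \<ge> 2"
  shows "odd_zeta s = (1 - 1 / 2 ^ s) * zeta s"
proof -
  have "(\<lambda>n. \<Sum>m\<in>{n * 2..<n * 2 + 2}. 1 / real (m + 1) ^ s) sums zeta s"
    using zeta_sums[OF assms] by (rule sums_group) simp
  moreover have "(\<Sum>m\<in>{n * 2..<n * 2 + 2}. 1 / real (m + 1) ^ s) =
      1 / real (2 * n + 1) ^ s + 1 / 2 ^ s * (1 / real (n + 1) ^ s)" for n
  proof -
    have "{n * 2..<n * 2 + 2} = {2 * n, 2 * n + 1}" by auto
    moreover have "real (2 * n + 1 + 1) = 2 * real (n + 1)" by simp
    ultimately show ?thesis
      by (simp add: power_mult_distrib[symmetric] distrib_left)
  qed
  moreover have "(\<lambda>n. 1 / real (2 * n + 1) ^ s + 1 / 2 ^ s * (1 / real (n + 1) ^ s)) sums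
      (odd_zeta s + 1 / 2 ^ s * zeta s)"
    by (intro sums_add sums_mult odd_zeta_sums zeta_sums assms)
  ultimately have "zeta s = odd_zeta s + 1 / 2 ^ s * zeta s"
    by (simp add: sums_unique2)
  then show ?thesis by (simp add: algebra_simps)
qed

text \<open>
  Nonzero rationality lets the factors \<open>\<zeta>(2l)\<close> be absorbed into rational coefficient polynomials.
\<close>

lemma zeta_even_rational:
  obtains z :: rat where "z \<noteq> 0" "zeta (2 * l) = (pi\<^sup>2 / 4) ^ l * of_rat z"
proof (cases "l = 0")
  case True
  then show ?thesis
    using that[of "- 1 / 2"] by (simp add: zeta_def of_rat_minus of_rat_divide)
next
  case False
  then have ge2: "2 * l \<ge> 2" by simp
  have pow: "(2::real) ^ (2 * l) > 1" using False by simp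
  define c :: rat where "c = 1 - 1 / 2 ^ (2 * l)"
  have c: "real_of_rat c = 1 - 1 / 2 ^ (2 * l)"
    by (simp add: c_def of_rat_diff of_rat_divide of_rat_power)
  have "real_of_rat c \<noteq> 0" using pow unfolding c by simp
  then have "c \<noteq> 0" by auto
  have "zeta (2 * l) > 0"
    using zeta_sums[OF ge2] suminf_pos[of "\<lambda>m. 1 / real (m + 1) ^ (2 * l)"]
    by (simp add: sums_iff)
  moreover have "real_of_rat c * zeta (2 * l) = (pi\<^sup>2 / 4) ^ l * of_rat (tan_coeff l) / 2"
    unfolding c using odd_zeta_eq_zeta[OF ge2] odd_zeta_eq_tan_coeff[of l] by simp
  ultimately have "zeta (2 * l) = (pi\<^sup>2 / 4) ^ l * of_rat (tan_coeff l / (2 * c))" "tan_coeff l \<noteq> 0"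
    using \<open>c \<noteq> 0\<close> by (auto simp: of_rat_divide of_rat_mult field_simps)
  with \<open>c \<noteq> 0\<close> show ?thesis by (intro that[of "tan_coeff l / (2 * c)"]) auto
qed

section \<open>The differential ring of the tangent series\<close>

text \<open>
  This is \<open>h = u tan u\<close> as a power series in \<open>X = u\<^sup>2\<close>.
\<close>

definition tan_series :: "rat fps" where
  "tan_series = Abs_fps tan_coeff"

definition euler_op :: "'a::comm_semiring_1 fps \<Rightarrow> 'a fps" where
  "euler_op F = fps_X * fps_deriv F"

lemma euler_op_nth [simp]: "euler_op F $ k = of_nat k * F $ k"
  by (cases k) (simp_all add: euler_op_def)

lemma euler_op_add: "euler_op (F + G) = euler_op F + euler_op G"
  by (simp add: euler_op_def distrib_left)

lemma euler_op_mult: "euler_op (F * G) = euler_op F * G + F * euler_op G"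
  for F G :: "'a::comm_ring_1 fps"
  by (simp add: euler_op_def algebra_simps)

lemma euler_op_const [simp]: "euler_op (fps_const c) = 0"
  by (simp add: euler_op_def)

lemma euler_op_X [simp]: "euler_op fps_X = fps_X"
  by (simp add: euler_op_def)

text \<open>
  In the variable \<open>u\<close> the operator \<open>X d/dX\<close> is \<open>(u/2) d/du\<close>, which accounts for the factor \<open>2\<close>.
\<close>

lemma tan_series_riccati: "2 * euler_op tan_series = tan_series + fps_X + tan_series ^ 2"
proof (rule fps_ext)
  fix k
  have "(2 * euler_op tan_series) $ k = 2 * of_nat k * tan_coeff k"
    by (simp add: tan_series_def numeral_fps_const)
  also note tan_coeff_riccati[of k]
  finally show "(2 * euler_op tan_series) $ k = (tan_series + fps_X + tan_series ^ 2) $ k"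
    by (simp add: power2_eq_square fps_mult_nth tan_series_def atLeast0AtMost)
qed

text \<open>
  Replacing \<open>tan u\<close> by its limit \<open>\<i>\<close> at \<open>\<i>\<infinity>\<close> turns \<open>h\<close> into \<open>s = \<i>u\<close> and \<open>X\<close> into \<open>- s\<^sup>2\<close>; the Riccati equation
  survives, since \<open>2 (s/2) = s - s\<^sup>2 + s\<^sup>2\<close>. Polynomials in \<open>s\<close> are called symbols, and \<open>X d/dX\<close> acts
  on them as \<open>(s/2) d/ds\<close>.
\<close>

definition symbol_op :: "rat poly \<Rightarrow> rat poly" where
  "symbol_op a = smult (1 / 2) (pCons 0 (pderiv a))"

lemma coeff_symbol_op: "coeff (symbol_op a) j = of_nat j / 2 * coeff a j"
  by (cases j) (simp_all add: symbol_op_def coeff_pderiv)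

lemma symbol_op_add: "symbol_op (a + b) = symbol_op a + symbol_op b"
  by (simp add: poly_eq_iff coeff_symbol_op algebra_simps)

lemma symbol_op_mult: "symbol_op (a * b) = symbol_op a * b + a * symbol_op b"
  by (simp add: symbol_op_def pderiv_mult smult_add_right algebra_simps)

lemma symbol_op_monom: "symbol_op (monom c j) = monom (of_nat j / 2 * c) j"
  by (simp add: poly_eq_iff coeff_symbol_op)

text \<open>
  The pairs of a polynomial in \<open>h\<close> (weight \<open>1\<close>) and \<open>X\<close> (weight \<open>2\<close>) of weight at most \<open>W\<close>, and its
  symbol. The symbol is a second component of the pair because the series does not visibly determine the
  polynomial in \<open>h\<close> and \<open>X\<close> that it comes from.
\<close>

inductive weighted :: "nat \<Rightarrow> rat fps \<Rightarrow> rat poly \<Rightarrow> bool" where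
  const: "weighted W (fps_const c) [:c:]"
| add: "weighted W A a \<Longrightarrow> weighted W B b \<Longrightarrow> weighted W (A + B) (a + b)"
| mult_tan: "weighted W A a \<Longrightarrow> weighted (Suc W) (tan_series * A) (monom 1 1 * a)"
| mult_X: "weighted W A a \<Longrightarrow> weighted (W + 2) (fps_X * A) (monom (-1) 2 * a)"

lemma weighted_mono: "weighted W A a \<Longrightarrow> W \<le> W' \<Longrightarrow> weighted W' A a"
proof (induction arbitrary: W' rule: weighted.induct)
  case (mult_tan W A a)
  then have "weighted (Suc (W' - 1)) (tan_series * A) (monom 1 1 * a)"
    by (intro weighted.mult_tan) auto
  with mult_tan show ?case by simp
next
  case (mult_X W A a)
  define V where "V = W' - 2"
  have "W \<le> V" and W': "W' = V + 2" using mult_X.prems by (auto simp: V_def)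
  then show ?case unfolding W' by (intro weighted.mult_X mult_X.IH)
qed (auto intro: weighted.intros)

lemma weighted_smult: "weighted W A a \<Longrightarrow> weighted W (fps_const c * A) (smult c a)"
proof (induction rule: weighted.induct)
  case (const W d)
  then show ?case using weighted.const[of W "c * d"] by simp
next
  case (add W A a B b)
  then show ?case using weighted.add by (simp add: distrib_left smult_add_right)
next
  case (mult_tan W A a)
  then show ?case using weighted.mult_tan[OF mult_tan.IH] by (simp add: mult_ac)
next
  case (mult_X W A a)
  then show ?case using weighted.mult_X[OF mult_X.IH] by (simp add: mult_ac)
qed

lemma weighted_mult:
  "weighted W A a \<Longrightarrow> weighted V B b \<Longrightarrow> weighted (W + V) (A * B) (a * b)"
proof (induction rule: weighted.induct)
  case (const W c)
  then have "weighted (W + V) (fps_const c * B) (smult c b)"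
    by (intro weighted_smult weighted_mono[OF const]) auto
  then show ?case by simp
next
  case (add W A a A' a')
  then show ?case using weighted.add by (simp add: distrib_right)
next
  case (mult_tan W A a)
  then show ?case using weighted.mult_tan[of "W + V" "A * B" "a * b"] by (simp add: mult_ac)
next
  case (mult_X W A a)
  then show ?case using weighted.mult_X[of "W + V" "A * B" "a * b"] by (simp add: mult_ac)
qed

text \<open>
  By the product rule it suffices to look at the generators: \<open>X\<close> is mapped to itself and \<open>h\<close> to
  \<open>(h + X + h\<^sup>2)/2\<close>, which has weight \<open>2\<close>.
\<close>

lemma weighted_euler_op: "weighted W A a \<Longrightarrow> weighted (Suc W) (euler_op A) (symbol_op a)"
proof (induction rule: weighted.induct)
  case (const W c)
  have "symbol_op [:c:] = [:0:]" by (simp add: symbol_op_def)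
  then show ?case using weighted.const[of "Suc W" 0] by simp
next
  case (add W A a B b)
  then show ?case using weighted.add by (simp add: euler_op_add symbol_op_add)
next
  case (mult_tan W A a)
  let ?h = tan_series
  let ?B = "fps_const (1/2) * (?h * A) + (fps_const (1/2) * (fps_X * A) + fps_const (1/2) * (?h * (?h * A)))"
  let ?b = "smult (1/2) (monom 1 1 * a) +
    (smult (1/2) (monom (-1) 2 * a) + smult (1/2) (monom 1 1 * (monom 1 1 * a)))"
  have half: "euler_op ?h = fps_const (1/2) * (?h + fps_X + ?h ^ 2)"
  proof -
    have "euler_op ?h = fps_const (1/2) * (2 * euler_op ?h)"
      by (simp add: numeral_fps_const mult.assoc[symmetric])
    then show ?thesis unfolding tan_series_riccati .
  qed
  have "weighted (Suc (Suc W)) (?B + ?h * euler_op A) (?b + monom 1 1 * symbol_op a)"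
  proof (intro weighted.add weighted_smult weighted.mult_tan mult_tan)
    show "weighted (Suc W) A a"
      by (rule weighted_mono[OF mult_tan.hyps]) simp
    show "weighted (Suc (Suc W)) (fps_X * A) (monom (- 1) 2 * a)"
      using weighted.mult_X[OF mult_tan.hyps] by simp
  qed
  moreover have "euler_op (?h * A) = ?B + ?h * euler_op A"
    unfolding euler_op_mult half by (simp add: algebra_simps power2_eq_square)
  moreover have "symbol_op (monom 1 1 * a) = ?b + monom 1 1 * symbol_op a"
  proof -
    have "monom 1 1 * (monom 1 1 * a) = monom 1 2 * a"
      by (simp only: mult.assoc[symmetric] mult_monom) (simp add: numeral_2_eq_2)
    moreover have "monom (-1) 2 * a = - (monom 1 2 * a)"
      by (simp add: minus_monom[symmetric] del: minus_monom)
    moreover have "symbol_op (monom 1 1) = smult (1/2) (monom 1 1)"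
      by (simp add: symbol_op_monom smult_monom)
    ultimately show ?thesis
      by (simp only: symbol_op_mult mult_smult_left smult_minus_right)
  qed
  ultimately show ?case by simp
next
  case (mult_X W A a)
  have "weighted (Suc W + 2) (fps_X * A + fps_X * euler_op A)
      (monom (-1) 2 * a + monom (-1) 2 * symbol_op a)"
    by (intro weighted.add weighted.mult_X mult_X weighted_mono[OF mult_X.hyps]) auto
  then show ?case
    by (simp add: euler_op_mult symbol_op_mult symbol_op_monom)
qed

section \<open>Reduction to linear combinations of derivatives\<close>

text \<open>
  The series \<open>A\<close> is \<open>\<Sum>\<^sub>l e\<^sub>l(D) (X\<^sup>l h) + \<Sum>\<^sub>k q\<^sub>k X\<^sup>k\<close> with \<open>D = X d/dX\<close>, stated for coefficients. On symbols,
  \<open>s\<^bsup>2l+1\<^esup>\<close> is an eigenvector of \<open>D\<close> with eigenvalue \<open>l + 1/2\<close>, so the symbol of \<open>e\<^sub>l(D) (X\<^sup>l h)\<close> is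
  \<open>(-1)\<^sup>l e\<^sub>l(l + 1/2) s\<^bsup>2l+1\<^esup>\<close>, whereas \<open>q\<^sub>l X\<^sup>l\<close> has the symbol \<open>(-1)\<^sup>l q\<^sub>l s\<^bsup>2l\<^esup>\<close>. The symbol thus determines all
  \<open>q\<^sub>l\<close>, and one value of each \<open>e\<^sub>l\<close>.
\<close>

definition reduced_form ::
  "nat \<Rightarrow> rat fps \<Rightarrow> rat poly \<Rightarrow> (nat \<Rightarrow> rat poly) \<Rightarrow> (nat \<Rightarrow> rat) \<Rightarrow> bool" where
  "reduced_form W A a e q \<longleftrightarrow>
    (\<forall>l. e l = 0 \<or> degree (e l) + 2 * l + 1 \<le> W) \<and>
    (\<forall>k. A $ k = (\<Sum>l\<le>k. poly (e l) (of_nat k) * tan_coeff (k - l)) + q k) \<and>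
    (\<forall>l. coeff a (2 * l) = (-1) ^ l * q l) \<and>
    (\<forall>l. coeff a (2 * l + 1) = (-1) ^ l * poly (e l) (of_nat l + 1 / 2))"

lemma reduced_formD:
  assumes "reduced_form W A a e q"
  shows "e l = 0 \<or> degree (e l) + 2 * l + 1 \<le> W"
    and "A $ k = (\<Sum>l\<le>k. poly (e l) (of_nat k) * tan_coeff (k - l)) + q k"
    and "coeff a (2 * l) = (-1) ^ l * q l"
    and "coeff a (2 * l + 1) = (-1) ^ l * poly (e l) (of_nat l + 1 / 2)"
  using assms unfolding reduced_form_def by blast+

definition reduced :: "nat \<Rightarrow> rat fps \<Rightarrow> rat poly \<Rightarrow> bool" where
  "reduced W A a \<longleftrightarrow> (\<exists>e q. reduced_form W A a e q)"

lemma reducedI: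
  assumes "\<And>l. e l = 0 \<or> degree (e l) + 2 * l + 1 \<le> W"
    and "\<And>k. A $ k = (\<Sum>l\<le>k. poly (e l) (of_nat k) * tan_coeff (k - l)) + q k"
    and "\<And>l. coeff a (2 * l) = (-1) ^ l * q l"
    and "\<And>l. coeff a (2 * l + 1) = (-1) ^ l * poly (e l) (of_nat l + 1 / 2)"
  shows "reduced W A a"
  using assms unfolding reduced_def reduced_form_def by blast

lemma reduced_mono:
  assumes "reduced W A a" "W \<le> W'"
  shows "reduced W' A a"
proof -
  obtain e q where "reduced_form W A a e q"
    using assms(1) unfolding reduced_def by blast
  note e = reduced_formD[OF this]
  show ?thesis
  proof (rule reducedI[where e = e and q = q])
    show "e l = 0 \<or> degree (e l) + 2 * l + 1 \<le> W'" for l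
      using e(1)[of l] assms(2) by auto
  qed (rule e)+
qed

lemma reduced_const: "reduced W (fps_const c) [:c:]"
proof (rule reducedI[where e = "\<lambda>_. 0" and q = "\<lambda>l. if l = 0 then c else 0"])
  show "coeff [:c:] (2 * l) = (-1) ^ l * (if l = 0 then c else 0)" for l
    by (cases l) auto
qed auto

lemma reduced_tan_series: "reduced 1 tan_series (monom 1 1)"
proof (rule reducedI[where e = "\<lambda>l. if l = 0 then 1 else 0" and q = "\<lambda>_. 0"])
  fix k
  have "(\<Sum>l\<le>k. poly (if l = 0 then 1 else 0) (of_nat k) * tan_coeff (k - l)) =
      (\<Sum>l\<le>k. if l = 0 then tan_coeff k else 0)"
    by (rule sum.cong) auto
  then show "tan_series $ k =
      (\<Sum>l\<le>k. poly (if l = 0 then 1 else 0) (of_nat k) * tan_coeff (k - l)) + 0"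
    by (simp add: tan_series_def)
qed (auto simp: Suc_double_not_eq_double)

lemma degree_add_bound:
  assumes "p = 0 \<or> degree p + c \<le> W" "q = 0 \<or> degree q + c \<le> W"
  shows "p + q = 0 \<or> degree (p + q) + c \<le> (W::nat)"
proof (cases "p = 0 \<or> q = 0")
  case False
  with assms degree_add_le_max[of p q] show ?thesis by auto
qed (use assms in auto)

lemma reduced_add:
  assumes "reduced W A a" "reduced W B b"
  shows "reduced W (A + B) (a + b)"
proof -
  obtain e q where "reduced_form W A a e q"
    using assms(1) unfolding reduced_def by blast
  note e = reduced_formD[OF this]
  obtain e' q' where "reduced_form W B b e' q'"
    using assms(2) unfolding reduced_def by blast
  note e' = reduced_formD[OF this]
  show ?thesis
  proof (rule reducedI[where e = "\<lambda>l. e l + e' l" and q = "\<lambda>l. q l + q' l"])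
    show "e l + e' l = 0 \<or> degree (e l + e' l) + 2 * l + 1 \<le> W" for l
      using degree_add_bound[of "e l" "2 * l + 1" W "e' l"] e(1)[of l] e'(1)[of l]
      by (simp add: add.assoc)
    show "(A + B) $ k =
        (\<Sum>l\<le>k. poly (e l + e' l) (of_nat k) * tan_coeff (k - l)) + (q k + q' k)" for k
      by (simp add: e(2) e'(2) distrib_right sum.distrib)
    show "coeff (a + b) (2 * l) = (-1) ^ l * (q l + q' l)" for l
      by (simp add: e(3) e'(3) distrib_left)
    show "coeff (a + b) (2 * l + 1) = (-1) ^ l * poly (e l + e' l) (of_nat l + 1 / 2)" for l
      unfolding coeff_add e(4) e'(4) by (simp add: distrib_left)
  qed
qed

lemma reduced_smult:
  assumes "reduced W A a"
  shows "reduced W (fps_const c * A) (smult c a)"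
proof -
  obtain e q where "reduced_form W A a e q"
    using assms unfolding reduced_def by blast
  note e = reduced_formD[OF this]
  show ?thesis
  proof (rule reducedI[where e = "\<lambda>l. smult c (e l)" and q = "\<lambda>l. c * q l"])
    show "smult c (e l) = 0 \<or> degree (smult c (e l)) + 2 * l + 1 \<le> W" for l
      using e(1)[of l] by auto
    show "(fps_const c * A) $ k =
        (\<Sum>l\<le>k. poly (smult c (e l)) (of_nat k) * tan_coeff (k - l)) + c * q k" for k
      by (simp add: e(2) sum_distrib_left distrib_left mult.assoc)
    show "coeff (smult c a) (2 * l) = (-1) ^ l * (c * q l)" for l
      by (simp add: e(3))
    show "coeff (smult c a) (2 * l + 1) = (-1) ^ l * poly (smult c (e l)) (of_nat l + 1 / 2)" for l
      unfolding coeff_smult e(4) by simp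
  qed
qed

text \<open>
  Applying \<open>D\<close> multiplies each \<open>e\<^sub>l\<close> by the indeterminate.
\<close>

lemma reduced_euler_op:
  assumes "reduced W A a"
  shows "reduced (Suc W) (euler_op A) (symbol_op a)"
proof -
  obtain e q where "reduced_form W A a e q"
    using assms unfolding reduced_def by blast
  note e = reduced_formD[OF this]
  show ?thesis
  proof (rule reducedI[where e = "\<lambda>l. pCons 0 (e l)" and q = "\<lambda>l. of_nat l * q l"])
    show "pCons 0 (e l) = 0 \<or> degree (pCons 0 (e l)) + 2 * l + 1 \<le> Suc W" for l
      using e(1)[of l] by auto
    show "euler_op A $ k =
        (\<Sum>l\<le>k. poly (pCons 0 (e l)) (of_nat k) * tan_coeff (k - l)) + of_nat k * q k" for k
      by (simp add: e(2) sum_distrib_left algebra_simps)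
    show "coeff (symbol_op a) (2 * l) = (-1) ^ l * (of_nat l * q l)" for l
      by (simp add: coeff_symbol_op e(3))
    show "coeff (symbol_op a) (2 * l + 1) = (-1) ^ l * poly (pCons 0 (e l)) (of_nat l + 1 / 2)" for l
      unfolding coeff_symbol_op e(4) by (simp add: field_simps)
  qed
qed

text \<open>
  Since \<open>X e(D) = e(D - 1) X\<close>, multiplication by \<open>X\<close> moves \<open>e\<^sub>l(x)\<close> to \<open>e\<^sub>l(x - 1)\<close> at index \<open>l + 1\<close>.
\<close>

lemma reduced_mult_X:
  assumes "reduced W A a"
  shows "reduced (W + 2) (fps_X * A) (monom (-1) 2 * a)"
proof -
  obtain e q where "reduced_form W A a e q"
    using assms unfolding reduced_def by blast
  note e = reduced_formD[OF this]
  define e' where "e' l = (case l of 0 \<Rightarrow> 0 | Suc m \<Rightarrow> pcompose (e m) [:-1, 1:])" for l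
  define q' where "q' l = (case l of 0 \<Rightarrow> 0 | Suc m \<Rightarrow> q m)" for l
  show ?thesis
  proof (rule reducedI[where e = e' and q = q'])
    show "e' l = 0 \<or> degree (e' l) + 2 * l + 1 \<le> W + 2" for l
    proof (cases l)
      case (Suc m)
      then show ?thesis using e(1)[of m] by (auto simp: e'_def degree_pcompose)
    qed (simp add: e'_def)
    show "(fps_X * A) $ k = (\<Sum>l\<le>k. poly (e' l) (of_nat k) * tan_coeff (k - l)) + q' k" for k
    proof (cases k)
      case (Suc m)
      then show ?thesis
        by (simp add: sum.atMost_Suc_shift e'_def q'_def poly_pcompose e(2) del: sum.atMost_Suc)
    qed (simp add: e'_def q'_def)
    show "coeff (monom (-1) 2 * a) (2 * l) = (-1) ^ l * q' l" for l
      by (cases l) (simp_all add: coeff_monom_mult q'_def e(3))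
    show "coeff (monom (-1) 2 * a) (2 * l + 1) = (-1) ^ l * poly (e' l) (of_nat l + 1 / 2)" for l
    proof (cases l)
      case (Suc m)
      have "coeff (monom (-1) 2 * a) (2 * l + 1) = - coeff a (2 * m + 1)"
        by (simp add: Suc coeff_monom_mult)
      also have "\<dots> = (-1) ^ l * poly (e' l) (of_nat l + 1 / 2)"
        unfolding e(4) by (simp add: Suc e'_def poly_pcompose add_ac)
      finally show ?thesis .
    qed (simp add: coeff_monom_mult e'_def)
  qed
qed

lemma euler_op_power:
  "euler_op (F ^ Suc m) = of_nat (Suc m) * F ^ m * euler_op F" for F :: "'a::comm_ring_1 fps"
  by (induction m) (simp_all add: euler_op_mult algebra_simps)

text \<open>
  The Riccati equation reads \<open>h\<^bsup>m+2\<^esup> = (2 / (m + 1)) D (h\<^bsup>m+1\<^esup>) - h\<^bsup>m+1\<^esup> - X h\<^sup>m\<close>, so that higher powers of \<open>h\<close>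
  are reached by differentiating lower ones.
\<close>

lemma reduced_tan_series_power: "reduced m (tan_series ^ m) (monom 1 m)"
proof (induction m rule: induct_nat_012)
  case 0
  show ?case using reduced_const[of 0 1] by (simp add: monom_0)
next
  case 1
  show ?case using reduced_tan_series by simp
next
  case (ge2 m)
  let ?h = tan_series and ?c = "2 / of_nat (Suc m) :: rat"
  have c: "fps_const ?c * of_nat (Suc m) = 2"
    unfolding fps_of_nat[symmetric] fps_const_mult numeral_fps_const
    by (simp del: of_nat_Suc)
  have "fps_const ?c * euler_op (?h ^ Suc m) = ?h ^ m * (2 * euler_op ?h)"
    unfolding euler_op_power c[symmetric] by (simp only: mult_ac)
  also have "\<dots> = ?h ^ Suc m + fps_X * ?h ^ m + ?h ^ Suc (Suc m)"
    unfolding tan_series_riccati by (simp add: algebra_simps power2_eq_square)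
  finally have step: "fps_const ?c * euler_op (?h ^ Suc m) =
      ?h ^ Suc m + fps_X * ?h ^ m + ?h ^ Suc (Suc m)" .
  have neg: "fps_const (-1) * F = - F" for F :: "rat fps"
    by (simp add: fps_const_neg[symmetric] del: fps_const_neg)
  have "reduced (Suc (Suc m)) (fps_const ?c * euler_op (?h ^ Suc m) +
      (fps_const (-1) * ?h ^ Suc m + fps_const (-1) * (fps_X * ?h ^ m)))
      (smult ?c (symbol_op (monom 1 (Suc m))) +
      (smult (-1) (monom 1 (Suc m)) + smult (-1) (monom (-1) 2 * monom 1 m)))"
    using ge2 reduced_mult_X[OF ge2(1)]
    by (intro reduced_add reduced_smult reduced_euler_op) (auto intro: reduced_mono)
  moreover have "fps_const ?c * euler_op (?h ^ Suc m) +
      (fps_const (-1) * ?h ^ Suc m + fps_const (-1) * (fps_X * ?h ^ m)) = ?h ^ Suc (Suc m)"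
    unfolding step neg by simp
  moreover have "smult ?c (symbol_op (monom 1 (Suc m))) +
      (smult (-1) (monom 1 (Suc m)) + smult (-1) (monom (-1) 2 * monom 1 m)) =
      monom 1 (Suc (Suc m))"
    by (simp add: symbol_op_monom mult_monom smult_monom add_monom del: of_nat_Suc)
  ultimately show ?case by simp
qed

text \<open>
  Reduced series are not visibly closed under multiplication by \<open>h\<close>. The induction therefore carries an
  arbitrary extra power of \<open>h\<close>, which absorbs each such factor.
\<close>

lemma weighted_imp_reduced: "weighted W A a \<Longrightarrow> reduced W A a"
proof -
  have "reduced (W + m) (A * tan_series ^ m) (a * monom 1 m)" if "weighted W A a" for m
    using that
  proof (induction arbitrary: m rule: weighted.induct)
    case (const W c)
    have "reduced (W + m) (fps_const c * tan_series ^ m) (smult c (monom 1 m))"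
      by (intro reduced_smult reduced_mono[OF reduced_tan_series_power]) simp
    then show ?case by simp
  next
    case (add W A a B b)
    then show ?case using reduced_add by (simp add: distrib_right)
  next
    case (mult_tan W A a)
    have "monom 1 1 * a * monom 1 m = a * monom 1 (Suc m)"
      by (metis mult.assoc mult.commute mult_monom mult_1 plus_1_eq_Suc)
    moreover have "tan_series * A * tan_series ^ m = A * tan_series ^ Suc m"
      by (simp add: mult_ac)
    ultimately show ?case using mult_tan.IH[of "Suc m"] by (simp only: add_Suc add_Suc_right)
  next
    case (mult_X W A a)
    then show ?case using reduced_mult_X[OF mult_X.IH[of m]] by (simp add: mult_ac add_ac)
  qed
  from this[of 0] show "weighted W A a \<Longrightarrow> reduced W A a" by (simp add: monom_0)
qed

lemma weighted_prod:
  assumes "finite J" "\<And>j. j \<in> J \<Longrightarrow> weighted (w j) (A j) (a j)"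
  shows "weighted (\<Sum>j\<in>J. w j) (\<Prod>j\<in>J. A j) (\<Prod>j\<in>J. a j)"
  using assms
proof (induction J rule: finite_induct)
  case empty
  show ?case using weighted.const[of 0 1] by (simp add: one_pCons)
next
  case (insert j J)
  then show ?case using weighted_mult by simp
qed

lemma weighted_euler_op_tan_series:
  "weighted (Suc i) ((euler_op ^^ i) tan_series) (monom ((1 / 2) ^ i) 1)"
proof (induction i)
  case 0
  show ?case using weighted.mult_tan[OF weighted.const[of 0 1]] by simp
next
  case (Suc i)
  show ?case using weighted_euler_op[OF Suc] by (simp add: symbol_op_monom)
qed

text \<open>
  The symbol of the product is a multiple of \<open>s\<^sup>n\<close>, and this restricts its reduced form in two ways.
  First, the polynomial part can only have a term \<open>X\<^bsup>n/2\<^esup>\<close>, of degree below \<open>n\<close>. Secondly, if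
  \<open>2l + 1 = R + n\<close> then \<open>e\<^sub>l\<close> is constant and equal to the value that the symbol prescribes up to sign,
  hence \<open>0\<close> unless \<open>2l + 1 = n\<close>.
\<close>

proposition euler_op_product_reduction:
  fixes \<rho> :: "nat \<Rightarrow> nat"
  assumes "finite J" "J \<noteq> {}"
  defines "n \<equiv> card J" and "R \<equiv> (\<Sum>j\<in>J. \<rho> j)"
  obtains e :: "nat \<Rightarrow> rat poly"
  where "\<And>l. e l = 0 \<or> degree (e l) + 2 * l + 1 \<le> R + n \<and> (2 * l + 2 \<le> R + n \<or> 2 * l + 1 \<le> n)"
    and "\<And>k. k \<ge> n \<Longrightarrow> (\<Prod>j\<in>J. (euler_op ^^ \<rho> j) tan_series) $ k =
      (\<Sum>l\<le>k. poly (e l) (of_nat k) * tan_coeff (k - l))"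
proof -
  let ?A = "\<Prod>j\<in>J. (euler_op ^^ \<rho> j) tan_series"
  have n: "n > 0" using assms by (simp add: card_gt_0_iff)
  have "weighted (\<Sum>j\<in>J. Suc (\<rho> j)) ?A (\<Prod>j\<in>J. monom ((1 / 2) ^ \<rho> j) 1)"
    by (intro weighted_prod weighted_euler_op_tan_series \<open>finite J\<close>)
  moreover have "(\<Sum>j\<in>J. Suc (\<rho> j)) = R + n"
    unfolding R_def n_def by (simp add: sum_Suc)
  moreover have "(\<Prod>j\<in>J. monom ((1 / 2) ^ \<rho> j) 1) = monom ((1 / 2 :: rat) ^ R) n"
    unfolding R_def n_def using \<open>finite J\<close>
    by (induction J rule: finite_induct) (auto simp: mult_monom power_add monom_0 one_pCons)
  ultimately have "reduced (R + n) ?A (monom ((1 / 2) ^ R) n)"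
    by (metis weighted_imp_reduced)
  then obtain e q where "reduced_form (R + n) ?A (monom ((1 / 2) ^ R) n) e q"
    unfolding reduced_def by blast
  note e = reduced_formD[OF this]
  show ?thesis
  proof (rule that[of e])
    fix l
    show "e l = 0 \<or> degree (e l) + 2 * l + 1 \<le> R + n \<and> (2 * l + 2 \<le> R + n \<or> 2 * l + 1 \<le> n)"
    proof (rule ccontr)
      assume *: "\<not> ?thesis"
      with e(1)[of l] have top: "degree (e l) = 0" "2 * l + 1 > n" by auto
      from top(1) obtain c where c: "e l = [:c:]" by (rule degree_eq_zeroE)
      from top(2) e(4)[of l] have "poly (e l) (of_nat l + 1 / 2) = 0" by simp
      with c * show False by simp
    qed
  next
    fix k assume "k \<ge> n"
    with n have "n \<noteq> 2 * k" by simp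
    with e(3)[of k] have "q k = 0" by simp
    then show "?A $ k = (\<Sum>l\<le>k. poly (e l) (of_nat k) * tan_coeff (k - l))"
      by (simp add: e(2))
  qed
qed

section \<open>Sums over compositions\<close>

text \<open>
  The exponent vectors in the expansion of the product form multisets over \<open>{1..n}\<close>; those in which some
  index is missing contribute \<open>0\<close> because the constant terms vanish.
\<close>

lemma fps_prod_nth_compositions:
  fixes F :: "nat \<Rightarrow> 'a::comm_ring_1 fps"
  assumes "\<And>j. j \<in> {1..n} \<Longrightarrow> F j $ 0 = 0"
  shows "(\<Prod>j=1..n. F j) $ k = (\<Sum>\<kappa>\<in>compositions n k. \<Prod>j=1..n. F j $ \<kappa> j)"
proof -
  let ?J = "{1..n}"
  let ?M = "multisets_of_size ?J k" and ?N = "{X \<in> multisets_of_size ?J k. \<exists>j\<in>?J. count X j = 0}"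
  define ms :: "(nat \<Rightarrow> nat) \<Rightarrow> nat multiset" where "ms \<kappa> = (\<Sum>j\<in>?J. replicate_mset (\<kappa> j) j)" for \<kappa>
  have count_ms: "count (ms \<kappa>) j = (if j \<in> ?J then \<kappa> j else 0)" for \<kappa> j
    by (simp add: ms_def count_sum count_replicate_mset)
  have size_eq: "size X = (\<Sum>j\<in>?J. count X j)" if "set_mset X \<subseteq> ?J" for X
    unfolding size_multiset_overloaded_eq using that
    by (intro sum.mono_neutral_left) (auto simp: not_in_iff)
  have "(\<Prod>j=1..n. F j) $ k = (\<Sum>X\<in>?M. \<Prod>j=1..n. F j $ count X j)"
    by (rule fps_prod_nth') simp
  also have "\<dots> = (\<Sum>\<kappa>\<in>compositions n k. \<Prod>j=1..n. F j $ \<kappa> j)"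
  proof (rule sum.reindex_bij_witness_not_neutral[where S' = ?N and T' = "{}" and i = ms
        and j = "\<lambda>X. restrict (count X) ?J"])
    show "finite ?N" by (simp add: finite_multisets_of_size)
    fix X assume "X \<in> ?M - ?N"
    then have X: "set_mset X \<subseteq> ?J" "size X = k" "\<And>j. j \<in> ?J \<Longrightarrow> count X j \<noteq> 0"
      by (auto simp: multisets_of_size_def)
    show "ms (restrict (count X) ?J) = X"
      using X(1) by (intro multiset_eqI) (auto simp: count_ms not_in_iff)
    show "restrict (count X) ?J \<in> compositions n k - {}"
      using X size_eq[OF X(1)] by (auto simp: compositions_def Suc_le_eq intro!: Nat.gr0I)
  next
    fix \<kappa> assume "\<kappa> \<in> compositions n k - {}"
    then have \<kappa>: "\<kappa> \<in> ?J \<rightarrow>\<^sub>E {1..}" "(\<Sum>j\<in>?J. \<kappa> j) = k"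
      by (auto simp: compositions_def)
    show "restrict (count (ms \<kappa>)) ?J = \<kappa>"
      using \<kappa>(1) by (auto simp: count_ms fun_eq_iff PiE_iff extensional_def)
    have sub: "set_mset (ms \<kappa>) \<subseteq> ?J"
      by (auto simp: count_ms set_mset_def split: if_splits)
    have "size (ms \<kappa>) = k"
      using size_eq[OF sub] \<kappa>(2) by (simp add: count_ms)
    moreover have "count (ms \<kappa>) j \<noteq> 0" if "j \<in> ?J" for j
      using PiE_mem[OF \<kappa>(1) that] that by (simp add: count_ms)
    ultimately show "ms \<kappa> \<in> ?M - ?N"
      using sub by (auto simp: multisets_of_size_def)
  next
    fix X assume "X \<in> ?N"
    then obtain j where "j \<in> ?J" "count X j = 0" by auto
    with assms show "(\<Prod>j=1..n. F j $ count X j) = 0"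
      by (intro prod_zero) (auto intro!: bexI[of _ j])
  qed auto
  finally show ?thesis .
qed

lemma euler_op_power_nth: "(euler_op ^^ i) F $ k = of_nat k ^ i * F $ k"
  by (induction i) (simp_all add: mult.assoc)

lemma mvpoly_eval_eq:
  assumes "mvpoly_vars f \<subseteq> J" "finite J"
  shows "mvpoly_eval f x =
    (\<Sum>m\<in>Poly_Mapping.keys f. Poly_Mapping.lookup f m * (\<Prod>j\<in>J. x j ^ Poly_Mapping.lookup m j))"
  unfolding mvpoly_eval_def
proof (rule sum.cong)
  fix m assume "m \<in> Poly_Mapping.keys f"
  with assms(1) have "Poly_Mapping.keys m \<subseteq> J" by (auto simp: mvpoly_vars_def)
  then have "(\<Prod>i\<in>Poly_Mapping.keys m. x i ^ Poly_Mapping.lookup m i) =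
      (\<Prod>j\<in>J. x j ^ Poly_Mapping.lookup m j)"
    using assms(2) by (intro prod.mono_neutral_left) (auto simp: in_keys_iff)
  then show "Poly_Mapping.lookup f m * (\<Prod>i\<in>Poly_Mapping.keys m. x i ^ Poly_Mapping.lookup m i) =
      Poly_Mapping.lookup f m * (\<Prod>j\<in>J. x j ^ Poly_Mapping.lookup m j)" by simp
qed simp

lemma monomial_degree_le:
  assumes "m \<in> Poly_Mapping.keys f" "mvpoly_vars f \<subseteq> J" "finite J"
  shows "(\<Sum>j\<in>J. Poly_Mapping.lookup m j) \<le> mvpoly_degree f"
proof -
  have "Poly_Mapping.keys m \<subseteq> J" using assms by (auto simp: mvpoly_vars_def)
  then have "(\<Sum>j\<in>J. Poly_Mapping.lookup m j) = (\<Sum>i\<in>Poly_Mapping.keys m. Poly_Mapping.lookup m i)"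
    using assms(3) by (intro sum.mono_neutral_right) (auto simp: in_keys_iff)
  also have "\<dots> \<le> mvpoly_degree f"
    unfolding mvpoly_degree_def using assms(1) by (intro Max_ge) auto
  finally show ?thesis .
qed

text \<open>
  Multiplying \<open>t(2k)\<close> by \<open>k\<^sup>i\<close> amounts to applying \<open>D\<^sup>i\<close> to the generating function, so that each monomial
  of \<open>f\<close> contributes one coefficient of a product of derivatives of \<open>h\<close>. The powers of \<open>\<pi>\<close> depend only
  on the sum \<open>k\<close> and factor out.
\<close>

lemma odd_zeta_composition_sum:
  assumes "mvpoly_vars f \<subseteq> {1..n}"
  shows "(\<Sum>\<kappa>\<in>compositions n k.
      of_rat (mvpoly_eval f (\<lambda>j. of_nat (\<kappa> j))) * (\<Prod>j=1..n. odd_zeta (2 * \<kappa> j))) =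
    (pi\<^sup>2 / 4) ^ k / 2 ^ n * of_rat (\<Sum>m\<in>Poly_Mapping.keys f. Poly_Mapping.lookup f m *
      (\<Prod>j=1..n. (euler_op ^^ Poly_Mapping.lookup m j) tan_series) $ k)"
proof -
  let ?K = "Poly_Mapping.keys f" and ?c = "Poly_Mapping.lookup f" and ?l = "Poly_Mapping.lookup"
  let ?p = "pi\<^sup>2 / 4"
  have zetas: "(\<Prod>j=1..n. odd_zeta (2 * \<kappa> j)) =
      ?p ^ k / 2 ^ n * of_rat (\<Prod>j=1..n. tan_coeff (\<kappa> j))" if "\<kappa> \<in> compositions n k" for \<kappa>
  proof -
    have "(\<Prod>j=1..n. odd_zeta (2 * \<kappa> j)) =
        ?p ^ (\<Sum>j=1..n. \<kappa> j) * of_rat (\<Prod>j=1..n. tan_coeff (\<kappa> j)) / 2 ^ n"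
      by (simp add: odd_zeta_eq_tan_coeff prod_dividef prod.distrib power_sum of_rat_prod)
    then show ?thesis using that by (simp add: compositions_def)
  qed
  have nth: "(\<Prod>j=1..n. (euler_op ^^ ?l m j) tan_series) $ k =
      (\<Sum>\<kappa>\<in>compositions n k. \<Prod>j=1..n. of_nat (\<kappa> j) ^ ?l m j * tan_coeff (\<kappa> j))" for m
    by (subst fps_prod_nth_compositions) (simp_all add: euler_op_power_nth tan_series_def)
  have "(\<Sum>\<kappa>\<in>compositions n k.
      of_rat (mvpoly_eval f (\<lambda>j. of_nat (\<kappa> j))) * (\<Prod>j=1..n. odd_zeta (2 * \<kappa> j))) =
    (\<Sum>\<kappa>\<in>compositions n k. ?p ^ k / 2 ^ n *
      of_rat (\<Sum>m\<in>?K. ?c m * (\<Prod>j=1..n. of_nat (\<kappa> j) ^ ?l m j * tan_coeff (\<kappa> j))))"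
  proof (rule sum.cong)
    fix \<kappa> assume \<kappa>: "\<kappa> \<in> compositions n k"
    have eq: "(\<Sum>m\<in>?K. ?c m * (\<Prod>j=1..n. of_nat (\<kappa> j) ^ ?l m j * tan_coeff (\<kappa> j))) =
        mvpoly_eval f (\<lambda>j. of_nat (\<kappa> j)) * (\<Prod>j=1..n. tan_coeff (\<kappa> j))"
      unfolding mvpoly_eval_eq[OF assms finite_atLeastAtMost]
      by (simp add: prod.distrib sum_distrib_right mult.assoc)
    show "of_rat (mvpoly_eval f (\<lambda>j. of_nat (\<kappa> j))) * (\<Prod>j=1..n. odd_zeta (2 * \<kappa> j)) =
        ?p ^ k / 2 ^ n *
        of_rat (\<Sum>m\<in>?K. ?c m * (\<Prod>j=1..n. of_nat (\<kappa> j) ^ ?l m j * tan_coeff (\<kappa> j)))"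
      unfolding eq zetas[OF \<kappa>] by (simp add: of_rat_mult)
  qed simp
  also have "\<dots> = ?p ^ k / 2 ^ n * of_rat (\<Sum>\<kappa>\<in>compositions n k.
      \<Sum>m\<in>?K. ?c m * (\<Prod>j=1..n. of_nat (\<kappa> j) ^ ?l m j * tan_coeff (\<kappa> j)))"
    by (simp only: of_rat_sum sum_distrib_left)
  also have "(\<Sum>\<kappa>\<in>compositions n k.
      \<Sum>m\<in>?K. ?c m * (\<Prod>j=1..n. of_nat (\<kappa> j) ^ ?l m j * tan_coeff (\<kappa> j))) =
      (\<Sum>m\<in>?K. ?c m * (\<Prod>j=1..n. (euler_op ^^ ?l m j) tan_series) $ k)"
    unfolding nth by (subst sum.swap) (simp only: sum_distrib_left)
  finally show ?thesis .
qed

theorem theorem1p2: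
  fixes n r T :: nat and f :: "rat mvpoly"
  assumes "n \<ge> 1"
    and "mvpoly_vars f \<subseteq> {1..n}"
    and "mvpoly_degree f = r"
    and "T = nat (max \<lfloor>(real r + real n - 2) / 2\<rfloor> \<lfloor>(real n - 1) / 2\<rfloor>)"
  shows "\<exists>e :: nat \<Rightarrow> rat poly.
    (\<forall>l\<le>T. e l = 0 \<or> int (degree (e l)) \<le> int r + int n - 2 * int l - 1) \<and>
    (\<forall>k\<ge>n.
      (\<Sum>\<kappa>\<in>compositions n k.
        of_rat (mvpoly_eval f (\<lambda>j. of_nat (\<kappa> j))) * (\<Prod>j=1..n. odd_zeta (2 * \<kappa> j)))
      = (\<Sum>l=0..min T k.
        of_rat (poly (e l) (of_nat k)) * zeta (2 * l) * odd_zeta (2 * k - 2 * l)))"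
proof -
  let ?K = "Poly_Mapping.keys f" and ?c = "Poly_Mapping.lookup f" and ?l = "Poly_Mapping.lookup"
  let ?p = "pi\<^sup>2 / 4"
  define good where "good m E \<longleftrightarrow>
      (\<forall>l. E l = 0 \<or> degree (E l) + 2 * l + 1 \<le> r + n \<and> l \<le> T) \<and>
      (\<forall>k\<ge>n. (\<Prod>j=1..n. (euler_op ^^ ?l m j) tan_series) $ k =
        (\<Sum>l\<le>k. poly (E l) (of_nat k) * tan_coeff (k - l)))" for m E
  have "\<exists>E. good m E" if "m \<in> ?K" for m
  proof -
    obtain E where E: "\<And>l. E l = 0 \<or> degree (E l) + 2 * l + 1 \<le> (\<Sum>j=1..n. ?l m j) + n \<and>
        (2 * l + 2 \<le> (\<Sum>j=1..n. ?l m j) + n \<or> 2 * l + 1 \<le> n)"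
      "\<And>k. k \<ge> n \<Longrightarrow> (\<Prod>j=1..n. (euler_op ^^ ?l m j) tan_series) $ k =
        (\<Sum>l\<le>k. poly (E l) (of_nat k) * tan_coeff (k - l))"
      using euler_op_product_reduction[of "{1..n}" "?l m"] assms(1) by auto
    have R: "(\<Sum>j=1..n. ?l m j) \<le> r"
      using monomial_degree_le[OF that assms(2)] assms(3) by simp
    have "l \<le> T" if "2 * l + 2 \<le> (\<Sum>j=1..n. ?l m j) + n \<or> 2 * l + 1 \<le> n" for l
    proof -
      have "real l \<le> (real r + real n - 2) / 2 \<or> real l \<le> (real n - 1) / 2"
        using that R by auto
      then have "int l \<le> max \<lfloor>(real r + real n - 2) / 2\<rfloor> \<lfloor>(real n - 1) / 2\<rfloor>"
        by (simp add: le_max_iff_disj le_floor_iff)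
      then show ?thesis unfolding assms(4) by linarith
    qed
    moreover have "degree (E l) + 2 * l + 1 \<le> r + n"
      if "degree (E l) + 2 * l + 1 \<le> (\<Sum>j=1..n. ?l m j) + n" for l
      using that R by linarith
    ultimately have "good m E" unfolding good_def using E by blast
    then show ?thesis by blast
  qed
  then obtain E where good: "\<And>m. m \<in> ?K \<Longrightarrow> good m (E m)"
    by metis
  have E: "E m l = 0 \<or> degree (E m l) + 2 * l + 1 \<le> r + n \<and> l \<le> T"
    and E_sum: "k \<ge> n \<Longrightarrow> (\<Prod>j=1..n. (euler_op ^^ ?l m j) tan_series) $ k =
        (\<Sum>l\<le>k. poly (E m l) (of_nat k) * tan_coeff (k - l))" if "m \<in> ?K" for m k l
    using good[OF that] unfolding good_def by blast+
  have "\<exists>z::rat. z \<noteq> 0 \<and> zeta (2 * l) = ?p ^ l * of_rat z" for l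
    by (rule zeta_even_rational) blast
  then obtain z :: "nat \<Rightarrow> rat" where z: "\<And>l. z l \<noteq> 0" "\<And>l. zeta (2 * l) = ?p ^ l * of_rat (z l)"
    by metis
  define g where "g l = (\<Sum>m\<in>?K. smult (?c m) (E m l))" for l
  \<comment> \<open>The constant cancels the factors \<open>z l\<close> of \<open>\<zeta>(2l)\<close> and \<open>1/2\<close> of \<open>t(2k - 2l)\<close> on the right, and supplies the
    factor \<open>1/2\<^sup>n\<close> from the \<open>n\<close> values of \<open>t\<close> on the left.\<close>
  define e where "e l = smult (2 / (2 ^ n * z l)) (g l)" for l
  have deg: "degree (e l) + 2 * l + 1 \<le> r + n \<and> l \<le> T" if "e l \<noteq> 0" for l
  proof -
    have "g l \<noteq> 0" using that by (auto simp: e_def)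
    then obtain m where "m \<in> ?K" "smult (?c m) (E m l) \<noteq> 0"
      unfolding g_def by (rule sum.not_neutral_contains_not_neutral)
    with E[of m l] have l: "2 * l + 1 \<le> r + n" "l \<le> T" by auto
    have "degree (g l) \<le> r + n - (2 * l + 1)"
      unfolding g_def
    proof (rule degree_sum_le)
      fix m assume "m \<in> ?K"
      then show "degree (smult (?c m) (E m l)) \<le> r + n - (2 * l + 1)"
        using E[of m l] degree_smult_le[of "?c m" "E m l"] by auto
    qed simp
    with l show ?thesis using degree_smult_le[of _ "g l"] by (force simp: e_def)
  qed
  show ?thesis
  proof (intro exI[of _ e] conjI allI impI)
    fix l
    show "e l = 0 \<or> int (degree (e l)) \<le> int r + int n - 2 * int l - 1"
      using deg[of l] by linarith
  next
    fix k assume k: "k \<ge> n"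
    have "(\<Sum>m\<in>?K. ?c m * (\<Prod>j=1..n. (euler_op ^^ ?l m j) tan_series) $ k) =
        (\<Sum>m\<in>?K. \<Sum>l\<le>k. ?c m * (poly (E m l) (of_nat k) * tan_coeff (k - l)))"
      using E_sum[OF _ k] by (simp add: sum_distrib_left)
    also have "\<dots> = (\<Sum>l\<le>k. poly (g l) (of_nat k) * tan_coeff (k - l))"
      by (subst sum.swap) (simp add: g_def poly_sum sum_distrib_right mult.assoc)
    finally have "(\<Sum>\<kappa>\<in>compositions n k.
        of_rat (mvpoly_eval f (\<lambda>j. of_nat (\<kappa> j))) * (\<Prod>j=1..n. odd_zeta (2 * \<kappa> j))) =
        (\<Sum>l\<le>k. ?p ^ k / 2 ^ n * of_rat (poly (g l) (of_nat k) * tan_coeff (k - l)))"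
      unfolding odd_zeta_composition_sum[OF assms(2)] by (simp add: of_rat_sum sum_distrib_left)
    also have "\<dots> = (\<Sum>l\<le>k.
        of_rat (poly (e l) (of_nat k)) * zeta (2 * l) * odd_zeta (2 * k - 2 * l))"
    proof (rule sum.cong)
      fix l assume "l \<in> {..k}"
      then have "?p ^ k = ?p ^ l * ?p ^ (k - l)" and "2 * k - 2 * l = 2 * (k - l)"
        by (auto simp: power_add[symmetric])
      moreover have "real_of_rat (z l) \<noteq> 0" using z(1) by simp
      ultimately show "?p ^ k / 2 ^ n * of_rat (poly (g l) (of_nat k) * tan_coeff (k - l)) =
          of_rat (poly (e l) (of_nat k)) * zeta (2 * l) * odd_zeta (2 * k - 2 * l)"
        by (simp add: e_def z(2) odd_zeta_eq_tan_coeff of_rat_mult of_rat_divide of_rat_power)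
    qed simp
    \<comment> \<open>\<open>e l = 0\<close> for \<open>l > T\<close>\<close>
    also have "\<dots> = (\<Sum>l=0..min T k.
        of_rat (poly (e l) (of_nat k)) * zeta (2 * l) * odd_zeta (2 * k - 2 * l))"
      using deg by (intro sum.mono_neutral_right) force+
    finally show "(\<Sum>\<kappa>\<in>compositions n k.
        of_rat (mvpoly_eval f (\<lambda>j. of_nat (\<kappa> j))) * (\<Prod>j=1..n. odd_zeta (2 * \<kappa> j))) =
        (\<Sum>l=0..min T k.
        of_rat (poly (e l) (of_nat k)) * zeta (2 * l) * odd_zeta (2 * k - 2 * l))" .
  qed
qed

end
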